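(* Let $G=(V,A)$ be a finite simple directed graph without self-loops, with arc utilities $u_{ij}\ge 0$ for $(i,j)\in A$, where $V$ is linearly ordered and every arc $(i,j)\in A$ satisfies $i<j$. Let each node $i\in V$ have a utility $u_{ii}\in\mathbb{R}$ (of arbitrary sign) and a cost $q_i\ge 0$, and let $\lambda\ge 0$ be a real number. Then the $\lambda$-QKP problem $$\max_{\emptyset\subset S\subset V}\; C(S,S)+\sum_{i\in S}u_{ii}-\lambda\sum_{i\in S}q_i$$ is equivalent to the problem $$\max_{\emptyset\subset S\subset V}\;\sum_{i\in S}\bigl(d_i^+ + u_{ii}-\lambda q_i\bigr)-C(S,\bar S),$$ that is, the two problems have the same optimal value and the same set of optimal solutions $S$.
   Context: For subsets $D_1,D_2\subseteq V$ define $C(D_1,D_2)=\sum_{i\in D_1,\,j\in D_2,\,(i,j)\in A}u_{ij}$. For $S\subseteq V$, $\bar S=V\setminus S$ denotes the complement of $S$. Thus $C(S,S)$ is the sum of $u_{ij}$ over arcs with both endpoints in $S$, and $C(S,\bar S)$ is the sum of $u_{ij}$ over arcs from $S$ to $\bar S$. For $i\in V$, $d_i^+=\sum_{j\,:\,(i,j)\in A}u_{ij}$ is the weighted out-degree of node $i$ in $G$. The symbol $\subset$ denotes (not necessarily proper) inclusion, so in both problems $S$ ranges over all subsets of $V$, corresponding to binary vectors $x\in\{0,1\}^V$ with $x_i=1$ if and only if $i\in S$. The $\lambda$-QKP problem is the Lagrangian relaxation, with multiplier $\lambda$ on the budget constraint $\sum_{i\in S}q_i\le B$ and the constant term $\lambda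 B$ omitted, of the Quadratic Knapsack Problem $\max\{C(S,S)+\sum_{i\in S}u_{ii} : S\subseteq V,\ \sum_{i\in S}q_i\le B\}$. *)

theory Defs
  imports Complex_Main "Graph_Theory.Pair_Digraph"
begin

definition arc_weight ::
    "'a pair_pre_digraph \<Rightarrow> ('a \<Rightarrow> 'a \<Rightarrow> real) \<Rightarrow> 'a set \<Rightarrow> 'a set \<Rightarrow> real"
  where "arc_weight G u D1 D2 = (\<Sum>(i, j) \<in> {(i, j) \<in> parcs G. i \<in> D1 \<and> j \<in> D2}. u i j)"

definition weighted_out_degree :: "'a pair_pre_digraph \<Rightarrow> ('a \<Rightarrow> 'a \<Rightarrow> real) \<Rightarrow> 'a \<Rightarrow> real"
  where "weighted_out_degree G u i = (\<Sum>j \<in> {j. (i, j) \<in> parcs G}. u i j)"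

text \<open>
  In the two objectives the off-diagonal values of \<open>u\<close> are arc utilities and the
  diagonal values \<open>u i i\<close> are node utilities. The graphs considered have no loops,
  so node utilities never enter \<open>arc_weight\<close> or \<open>weighted_out_degree\<close>.
\<close>

definition lambda_qkp_objective ::
    "'a pair_pre_digraph \<Rightarrow> ('a \<Rightarrow> 'a \<Rightarrow> real) \<Rightarrow> ('a \<Rightarrow> real) \<Rightarrow> real \<Rightarrow> 'a set \<Rightarrow> real"
  where "lambda_qkp_objective G u q lam S =
    arc_weight G u S S + (\<Sum>i \<in> S. u i i) - lam * (\<Sum>i \<in> S. q i)"

definition cut_objective ::
    "'a pair_pre_digraph \<Rightarrow> ('a \<Rightarrow> 'a \<Rightarrow> real) \<Rightarrow> ('a \<Rightarrow> real) \<Rightarrow> real \<Rightarrow> 'a set \<Rightarrow> real"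
  where "cut_objective G u q lam S =
    (\<Sum>i \<in> S. weighted_out_degree G u i + u i i - lam * q i) - arc_weight G u S (pverts G - S)"

end

theory Submission
  imports Defs
begin

text \<open>
  An arc leaving a node of \<open>S\<close> ends either in \<open>S\<close> or outside it, so the out-degrees of the
  nodes of \<open>S\<close> sum to \<open>C(S,S) + C(S,V - S)\<close>. Hence the two objectives are equal on every
  \<open>S \<subseteq> V\<close>.
\<close>

lemma sum_weighted_out_degree:
  fixes G :: "'a pair_pre_digraph"
  assumes "pair_fin_digraph G" and "S \<subseteq> pverts G"
  shows "(\<Sum>i\<in>S. weighted_out_degree G u i) = arc_weight G u S S + arc_weight G u S (pverts G - S)"
proof -
  interpret pair_fin_digraph G by fact
  let ?A = "\<lambda>D. {(i, j) \<in> parcs G. i \<in> S \<and> j \<in> D}"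
  have fin: "finite (?A D)" for D
    by (rule finite_subset[OF _ pair_finite_arcs]) auto
  have finS: "finite S"
    using assms(2) pair_finite_verts finite_subset by blast
  have fin_out: "finite {j. (i, j) \<in> parcs G}" for i
    by (rule finite_subset[OF _ pair_finite_verts]) (auto dest: in_arcsD2)
  \<comment> \<open>The iterated sum over tails and heads becomes one sum over the arcs with tail in
    \<open>S\<close>; \<open>sum.Sigma\<close> requires \<open>finS\<close> and
    \<open>fin_out\<close>.\<close>
  have "(\<Sum>i\<in>S. weighted_out_degree G u i)
      = (\<Sum>(i, j)\<in>(SIGMA i:S. {j. (i, j) \<in> parcs G}). u i j)"
    unfolding weighted_out_degree_def using finS fin_out by (simp add: sum.Sigma)
  \<comment> \<open>Every head lies in \<open>pverts G\<close> by \<open>in_arcsD2\<close>, so a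
    head outside \<open>S\<close> lies in \<open>pverts G - S\<close> and no arc is lost.\<close>
  also have "(SIGMA i:S. {j. (i, j) \<in> parcs G}) = ?A S \<union> ?A (pverts G - S)"
    by (auto dest: in_arcsD2)
  also have "(\<Sum>(i, j)\<in>\<dots>. u i j) = arc_weight G u S S + arc_weight G u S (pverts G - S)"
    unfolding arc_weight_def by (intro sum.union_disjoint fin) auto
  finally show ?thesis .
qed

text \<open>The subtracted cut weight cancels the part of the degree sum that leaves
  \<open>S\<close>. Linearity of the sum matches the node utilities and costs.\<close>

lemma lambda_qkp_objective_eq_cut_objective:
  fixes G :: "'a pair_pre_digraph"
  assumes "pair_fin_digraph G" and "S \<subseteq> pverts G"
  shows "lambda_qkp_objective G u q lam S = cut_objective G u q lam S"
  using sum_weighted_out_degree[OF assms, of u]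
  by (simp add: lambda_qkp_objective_def cut_objective_def
      sum.distrib sum_subtractf sum_distrib_left)

theorem lemma1:
  fixes G :: "'a::linorder pair_pre_digraph"
    and u :: "'a \<Rightarrow> 'a \<Rightarrow> real" and q :: "'a \<Rightarrow> real" and lam :: real
  assumes "pair_digraph G"
    and "\<And>i j. (i, j) \<in> parcs G \<Longrightarrow> i < j"
    and "\<And>i j. (i, j) \<in> parcs G \<Longrightarrow> 0 \<le> u i j"
    and "\<And>i. i \<in> pverts G \<Longrightarrow> 0 \<le> q i"
    and "0 \<le> lam"
  shows "Max (lambda_qkp_objective G u q lam ` Pow (pverts G)) =
           Max (cut_objective G u q lam ` Pow (pverts G)) \<and>
         {S. is_arg_max (lambda_qkp_objective G u q lam) (\<lambda>S. S \<subseteq> pverts G) S} =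
           {S. is_arg_max (cut_objective G u q lam) (\<lambda>S. S \<subseteq> pverts G) S}"
proof -
  interpret pair_digraph G by fact
  have eq: "lambda_qkp_objective G u q lam S = cut_objective G u q lam S"
    if "S \<subseteq> pverts G" for S
    using that pair_fin_digraph_axioms by (rule lambda_qkp_objective_eq_cut_objective[rotated])
  then have "lambda_qkp_objective G u q lam ` Pow (pverts G)
      = cut_objective G u q lam ` Pow (pverts G)"
    by (intro image_cong) auto
  \<comment> \<open>\<open>is_arg_max\<close> compares values at feasible sets only, so agreement on
    subsets of \<open>pverts G\<close> suffices.\<close>
  moreover have "is_arg_max (lambda_qkp_objective G u q lam) (\<lambda>S. S \<subseteq> pverts G) S
      \<longleftrightarrow> is_arg_max (cut_objective G u q lam) (\<lambda>S. S \<subseteq> pverts G) S" for S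
    by (auto simp: is_arg_max_def eq)
  ultimately show ?thesis
    by simp
qed

end
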